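(* Let $d$ be fixed and let $(E_m,\mathcal{B}_m)_{m\ge1}$ be an EEA family of symmetric graphicable $d$-regular evolution algebras over $\mathbb{C}$ with $n_m=\dim E_m\to\infty$. Let $\lambda_2^{(m)}$ be the second largest eigenvalue of the structural matrix $A_m$ of $E_m$ with respect to $\mathcal{B}_m$. Then $$\liminf_{m\to\infty}\lambda_2^{(m)}\ge2\sqrt{d-1}.$$
   Context: An evolution algebra over $\mathbb{C}$ (finite-dimensional) is an algebra $E$ with a linear basis $\mathcal{B}=\{e_1,\dots,e_n\}$ (a natural basis) such that $e_ie_j=0$ for $i\neq j$ and $e_i^2=\sum_k a_{ik}e_k$ with $a_{ik}\in\mathbb{C}$; $A=(a_{ik})$ is the structural matrix. It is symmetric if $a_{ij}=a_{ji}$ for all $i\ne j$, and graphicable if $a_{ij}\in\{0,1\}$ for all $i\neq j$ and $a_{ii}=0$ for all $i$. The graph $\Gamma(E,\mathcal{B})$ is the simple graph with vertex set $\{1,\dots,n\}$ and edges $\{i,j\}$, $i\ne j$, whenever $a_{ij}\neq0$ or $a_{ji}\ne0$; thus $A$ is the adjacency matrix of $\Gamma(E,\mathcal{B})$ when $E$ is symmetric and graphicable, and eigenvalues are real and listed with multiplicity in decreasing order. $E$ is $d$-regular if every vertex of $\Gamma(E,\mathcal{B})$ has exactly $d$ neighbours. For a finite simple graph $\Gamma$ with vertex set $V$ and $W\subseteq V$, let $E(W)$ be the set of edges with exactly one endpoint in $W$; the Cheeger constant is $\mathfrak{h}(\Gamma)=\min\{|E(W)|/|W| : \emptyset\ne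 W\subsetneq V,\ |W|\le |V|/2\}$, with $\mathfrak{h}(\Gamma)=+\infty$ if $|V|\le1$. Put $\mathfrak{h}(E,\mathcal{B})=\mathfrak{h}(\Gamma(E,\mathcal{B}))$. A family $(E_m,\mathcal{B}_m)_{m\ge1}$ with $\dim E_m\to\infty$ is an EEA family if $\inf_m\mathfrak{h}(E_m,\mathcal{B}_m)>0$. *)

theory Defs
  imports
    "HOL-Library.Extended_Real"
    "Jordan_Normal_Form.VS_Connect"
    "Jordan_Normal_Form.Char_Poly"
begin

text \<open>A complex algebra is a complex vector space with a bilinear product; it is neither assumed
  to be associative nor commutative nor unital, so the locale \<open>algebra\<close> of HOL-Algebra does not
  apply. We reuse the record \<open>module\<close>; its field \<open>one\<close> carries no meaning here.\<close>

locale complex_algebra =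
  vectorspace "class_ring :: complex ring" E for E :: "(complex, 'a) module" +
  assumes alg_mult_closed:
      "\<lbrakk>x \<in> carrier E; y \<in> carrier E\<rbrakk> \<Longrightarrow> x \<otimes>\<^bsub>E\<^esub> y \<in> carrier E"
    and alg_add_left:
      "\<lbrakk>x \<in> carrier E; y \<in> carrier E; z \<in> carrier E\<rbrakk> \<Longrightarrow>
        (x \<oplus>\<^bsub>E\<^esub> y) \<otimes>\<^bsub>E\<^esub> z = (x \<otimes>\<^bsub>E\<^esub> z) \<oplus>\<^bsub>E\<^esub> (y \<otimes>\<^bsub>E\<^esub> z)"
    and alg_add_right:
      "\<lbrakk>x \<in> carrier E; y \<in> carrier E; z \<in> carrier E\<rbrakk> \<Longrightarrow>
        z \<otimes>\<^bsub>E\<^esub> (x \<oplus>\<^bsub>E\<^esub> y) = (z \<otimes>\<^bsub>E\<^esub> x) \<oplus>\<^bsub>E\<^esub> (z \<otimes>\<^bsub>E\<^esub> y)"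
    and alg_smult_left:
      "\<lbrakk>x \<in> carrier E; y \<in> carrier E\<rbrakk> \<Longrightarrow>
        (c \<odot>\<^bsub>E\<^esub> x) \<otimes>\<^bsub>E\<^esub> y = c \<odot>\<^bsub>E\<^esub> (x \<otimes>\<^bsub>E\<^esub> y)"
    and alg_smult_right:
      "\<lbrakk>x \<in> carrier E; y \<in> carrier E\<rbrakk> \<Longrightarrow>
        x \<otimes>\<^bsub>E\<^esub> (c \<odot>\<^bsub>E\<^esub> y) = c \<odot>\<^bsub>E\<^esub> (x \<otimes>\<^bsub>E\<^esub> y)"

text \<open>Bases are ordered, hence given as lists, and basis vectors are numbered from \<open>0\<close> to
  \<open>length B - 1\<close> instead of from \<open>1\<close> to \<open>n\<close>. The condition that each square is a linear
  combination of \<open>B\<close> is automatic.\<close>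

definition natural_basis :: "(complex, 'a) module \<Rightarrow> 'a list \<Rightarrow> bool" where
  "natural_basis E B \<longleftrightarrow>
     distinct B \<and> vectorspace.basis class_ring E (set B) \<and>
     (\<forall>i<length B. \<forall>j<length B. i \<noteq> j \<longrightarrow> B ! i \<otimes>\<^bsub>E\<^esub> B ! j = \<zero>\<^bsub>E\<^esub>)"

definition evolution_algebra :: "(complex, 'a) module \<Rightarrow> 'a list \<Rightarrow> bool" where
  "evolution_algebra E B \<longleftrightarrow> complex_algebra E \<and> natural_basis E B"

definition coordinates :: "(complex, 'a) module \<Rightarrow> 'a list \<Rightarrow> 'a \<Rightarrow> 'a \<Rightarrow> complex" where
  "coordinates E B x = (THE a. a \<in> set B \<rightarrow>\<^sub>E UNIV \<and> module.lincomb E a (set B) = x)"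

definition structural_matrix :: "(complex, 'a) module \<Rightarrow> 'a list \<Rightarrow> complex mat" where
  "structural_matrix E B =
     mat (length B) (length B) (\<lambda>(i, k). coordinates E B (B ! i \<otimes>\<^bsub>E\<^esub> B ! i) (B ! k))"

definition symmetric_evolution_algebra :: "(complex, 'a) module \<Rightarrow> 'a list \<Rightarrow> bool" where
  "symmetric_evolution_algebra E B \<longleftrightarrow> evolution_algebra E B \<and>
     (\<forall>i<length B. \<forall>j<length B. i \<noteq> j \<longrightarrow>
        structural_matrix E B $$ (i, j) = structural_matrix E B $$ (j, i))"

definition graphicable_evolution_algebra :: "(complex, 'a) module \<Rightarrow> 'a list \<Rightarrow> bool" where
  "graphicable_evolution_algebra E B \<longleftrightarrow> evolution_algebra E B \<and>
     (\<forall>i<length B. \<forall>j<length B. i \<noteq> j \<longrightarrow> structural_matrix E B $$ (i, j) \<in> {0, 1}) \<and>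
     (\<forall>i<length B. structural_matrix E B $$ (i, i) = 0)"

text \<open>A simple graph is a pair of a vertex set and a set of two-element sets of vertices.\<close>

type_synonym 'v simple_graph = "'v set \<times> 'v set set"

definition evolution_graph :: "(complex, 'a) module \<Rightarrow> 'a list \<Rightarrow> nat simple_graph" where
  "evolution_graph E B =
     ({..<length B},
      {{i, j} | i j. i < length B \<and> j < length B \<and> i \<noteq> j \<and>
         (structural_matrix E B $$ (i, j) \<noteq> 0 \<or> structural_matrix E B $$ (j, i) \<noteq> 0)})"

definition neighbours :: "'v simple_graph \<Rightarrow> 'v \<Rightarrow> 'v set" where
  "neighbours G v = {u \<in> fst G. {v, u} \<in> snd G}"

definition regular_evolution_algebra :: "nat \<Rightarrow> (complex, 'a) module \<Rightarrow> 'a list \<Rightarrow> bool" where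
  "regular_evolution_algebra d E B \<longleftrightarrow> evolution_algebra E B \<and>
     (\<forall>v \<in> fst (evolution_graph E B). card (neighbours (evolution_graph E B) v) = d)"

definition edge_boundary :: "'v simple_graph \<Rightarrow> 'v set \<Rightarrow> 'v set set" where
  "edge_boundary G W = {e \<in> snd G. card (e \<inter> W) = 1}"

definition cheeger_constant :: "'v simple_graph \<Rightarrow> ereal" where
  "cheeger_constant G =
     (if card (fst G) \<le> 1 then \<infinity>
      else Min {ereal (real (card (edge_boundary G W)) / real (card W)) | W.
                  W \<noteq> {} \<and> W \<subset> fst G \<and> real (card W) \<le> real (card (fst G)) / 2})"

text \<open>Families are indexed by \<open>m \<ge> 1\<close>; the members with index \<open>0\<close> are irrelevant.\<close>

definition EEA_family :: "(nat \<Rightarrow> (complex, 'a) module) \<Rightarrow> (nat \<Rightarrow> 'a list) \<Rightarrow> bool" where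
  "EEA_family E B \<longleftrightarrow>
     (\<forall>m\<ge>1. evolution_algebra (E m) (B m)) \<and>
     filterlim (\<lambda>m. vectorspace.dim class_ring (E m)) at_top sequentially \<and>
     (INF m\<in>{1..}. cheeger_constant (evolution_graph (E m) (B m))) > 0"

text \<open>The eigenvalues in decreasing order, repeated according to their (algebraic) multiplicity as
  roots of the characteristic polynomial. This is meant for matrices with only real eigenvalues,
  where \<open>Re\<close> just moves them from \<^typ>\<open>complex\<close> to \<^typ>\<open>real\<close>.\<close>

definition eigenvalues_decreasing :: "complex mat \<Rightarrow> real list" where
  "eigenvalues_decreasing M = rev (sorted_list_of_multiset (image_mset Re (proots (char_poly M))))"

text \<open>Unspecified for matrices with fewer than two rows.\<close>

definition second_largest_eigenvalue :: "complex mat \<Rightarrow> real" where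
  "second_largest_eigenvalue M = eigenvalues_decreasing M ! 1"

end

theory Submission
  imports Defs "Jordan_Normal_Form.Schur_Decomposition"
begin

text \<open>Alon--Boppana by the trace method. Let \<open>P\<^sub>k\<close> be the matrix
  counting the non-backtracking walks of length \<open>k\<close>; it is a polynomial in the adjacency matrix \<open>A\<close>,
  has nonnegative entries, and satisfies \<open>A P\<^sub>k = P\<^bsub>k+1\<^esub> + (d - 1) P\<^bsub>k-1\<^esub>\<close> for \<open>k \<ge> 2\<close>. For every \<open>\<rho>\<close> of
  the form \<open>2 sqrt (d - 1) cos (\<pi> / (m + 2))\<close> there are weights \<open>s\<^sub>k \<ge> 0\<close>, depending only on \<open>d\<close> and \<open>m\<close>,
  such that \<open>H = h(A) = \<Sum>k\<le>m. s\<^sub>k P\<^sub>k\<close> satisfies \<open>A H \<ge> \<rho> H\<close> entrywise. If \<open>\<lambda>\<^sub>2 \<le> \<mu> < \<rho>\<close>, then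
  \<open>tr ((A - \<mu>) H\<^sup>2) \<ge> (\<rho> - \<mu>) s\<^sub>0\<^sup>2 n\<close>, whereas the same trace is \<open>\<Sum>i. (\<lambda>\<^sub>i - \<mu>) h(\<lambda>\<^sub>i)\<^sup>2\<close>, in which only
  the term of \<open>\<lambda>\<^sub>1 \<in> [-d, d]\<close> can be positive. This bounds \<open>n\<close> in terms of \<open>d\<close> and \<open>\<mu>\<close>.\<close>

section \<open>Non-backtracking walks in a regular graph\<close>

locale regular_graph =
  fixes n d :: nat and N :: "nat \<Rightarrow> nat set"
  assumes N_sub: "i < n \<Longrightarrow> N i \<subseteq> {..<n}"
    and N_card: "i < n \<Longrightarrow> card (N i) = d"
    and N_sym: "\<lbrakk>i < n; j \<in> N i\<rbrakk> \<Longrightarrow> i \<in> N j"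
begin

text \<open>The walks counted here are non-backtracking; \<open>u\<close> is the vertex visited just before \<open>v\<close>.\<close>

fun nb_walks_avoiding :: "nat \<Rightarrow> nat \<Rightarrow> nat \<Rightarrow> nat \<Rightarrow> real" where
  "nb_walks_avoiding 0 u v w = of_bool (v = w)"
| "nb_walks_avoiding (Suc k) u v w = (\<Sum>x\<in>N v - {u}. nb_walks_avoiding k v x w)"

fun nb_walks :: "nat \<Rightarrow> nat \<Rightarrow> nat \<Rightarrow> real" where
  "nb_walks 0 v w = of_bool (v = w)"
| "nb_walks (Suc k) v w = (\<Sum>x\<in>N v. nb_walks_avoiding k v x w)"

lemma nb_walks_avoiding_nonneg: "nb_walks_avoiding k u v w \<ge> 0"
  by (induction k arbitrary: u v) (auto intro: sum_nonneg)

lemma nb_walks_nonneg: "nb_walks k v w \<ge> 0"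
  by (cases k) (auto intro: sum_nonneg nb_walks_avoiding_nonneg)

lemma finite_N: "i < n \<Longrightarrow> finite (N i)"
  using N_sub finite_subset by blast

lemma N_less: "i < n \<Longrightarrow> j \<in> N i \<Longrightarrow> j < n"
  using N_sub by blast

lemma sum_nb_walks_0: "(\<Sum>x\<in>N v. nb_walks 0 x w) = nb_walks 1 v w"
  by simp

text \<open>Walks of length \<open>k + 1\<close> from a neighbour \<open>x\<close> of
  \<open>v\<close> split according to whether the first step returns to \<open>v\<close>. Those that
  do not, prefixed with the step from \<open>v\<close> to \<open>x\<close>, are the non-backtracking
  walks of length \<open>k + 2\<close> from \<open>v\<close>.\<close>

lemma sum_nb_walks_Suc:
  assumes "v < n"
  shows "(\<Sum>x\<in>N v. nb_walks (Suc k) x w) =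
    nb_walks (k + 2) v w + (\<Sum>x\<in>N v. nb_walks_avoiding k x v w)"
proof -
  have "nb_walks (Suc k) x w = nb_walks_avoiding (Suc k) v x w + nb_walks_avoiding k x v w"
    if "x \<in> N v" for x
    using sum.remove[OF finite_N N_sym, of x v] that assms N_less[OF assms that]
    by (simp add: add.commute)
  then show ?thesis by (simp add: sum.distrib)
qed

lemma sum_nb_walks_1:
  assumes "v < n"
  shows "(\<Sum>x\<in>N v. nb_walks 1 x w) = nb_walks 2 v w + real d * nb_walks 0 v w"
  \<comment> \<open>For \<open>k = 0\<close> the returning walk stops at \<open>v\<close>, so no
    continuation is excluded and each of the \<open>d\<close> neighbours contributes fully: hence
    \<open>d\<close> here and \<open>d - 1\<close> for longer walks.\<close>
  using sum_nb_walks_Suc[OF assms, of 0 w] N_card[OF assms] by (simp del: nb_walks.simps(2) add: numeral_2_eq_2)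

text \<open>After the return to \<open>v\<close> the continuation must avoid \<open>x\<close>. Over
  all \<open>x\<close> the excluded continuations make up every walk of length \<open>k + 1\<close>
  from \<open>v\<close> exactly once, which turns the factor \<open>d\<close> into
  \<open>d - 1\<close>.\<close>

lemma sum_nb_walks_Suc_Suc:
  assumes "v < n"
  shows "(\<Sum>x\<in>N v. nb_walks (k + 2) x w) = nb_walks (k + 3) v w + (real d - 1) * nb_walks (k + 1) v w"
proof -
  have "(\<Sum>x\<in>N v. nb_walks_avoiding (Suc k) x v w)
      = (\<Sum>x\<in>N v. nb_walks (k + 1) v w - nb_walks_avoiding k v x w)"
    using finite_N[OF assms] by (intro sum.cong) (auto simp: sum.remove)
  also have "\<dots> = (real d - 1) * nb_walks (k + 1) v w"
    using N_card[OF assms] by (simp add: sum_subtractf algebra_simps)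
  finally show ?thesis
    using sum_nb_walks_Suc[OF assms, of "Suc k" w] by (simp del: nb_walks.simps nb_walks_avoiding.simps add: numeral_3_eq_3)
qed

definition walk_sum :: "(nat \<Rightarrow> real) \<Rightarrow> nat \<Rightarrow> nat \<Rightarrow> nat \<Rightarrow> real" where
  "walk_sum s m v w = (\<Sum>k\<le>m. s k * nb_walks k v w)"

lemma walk_sum_0: "walk_sum s 0 v w = s 0 * nb_walks 0 v w"
  and walk_sum_Suc: "walk_sum s (Suc m) v w = walk_sum s m v w + s (Suc m) * nb_walks (Suc m) v w"
  by (simp_all add: walk_sum_def del: nb_walks.simps)

text \<open>The walk recurrence transposed to the weights: walks of length \<open>k\<close> arise
  from \<open>s (k - 1)\<close> by extension and from \<open>s (k + 1)\<close> by returning. Both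
  boundary terms stay explicit, so that the induction works for arbitrary \<open>s\<close>.\<close>

lemma sum_walk_sum:
  assumes "v < n"
  shows "(\<Sum>x\<in>N v. walk_sum s (Suc m) x w) =
    real d * s 1 * nb_walks 0 v w +
    (\<Sum>k=1..m. (s (k - 1) + (real d - 1) * s (k + 1)) * nb_walks k v w) +
    s m * nb_walks (m + 1) v w + s (m + 1) * nb_walks (m + 2) v w"
proof (induction m)
  case 0
  show ?case
    using sum_nb_walks_0[where v=v and w=w] sum_nb_walks_1[OF assms, of w]
    by (simp add: walk_sum_def sum.distrib algebra_simps numeral_2_eq_2
             flip: sum_distrib_left del: nb_walks.simps)
next
  case (Suc m)
  have "(\<Sum>x\<in>N v. walk_sum s (Suc (Suc m)) x w) = (\<Sum>x\<in>N v. walk_sum s (Suc m) x w)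
     + s (m+2) * (\<Sum>x\<in>N v. nb_walks (m + 2) x w)"
    by (simp add: walk_sum_Suc[of s "Suc m"] sum.distrib sum_distrib_left del: nb_walks.simps)
  then show ?case unfolding Suc.IH sum_nb_walks_Suc_Suc[OF assms]
    by (simp add: algebra_simps numeral_3_eq_3 numeral_2_eq_2 del: nb_walks.simps)
qed

lemma walk_sum_nonneg:
  assumes "\<And>k. k \<le> m \<Longrightarrow> s k \<ge> 0"
  shows "walk_sum s m v w \<ge> 0"
  unfolding walk_sum_def using assms nb_walks_nonneg by (intro sum_nonneg) auto

lemma walk_sum_diagonal:
  assumes "\<And>k. k \<le> m \<Longrightarrow> s k \<ge> 0"
  shows "walk_sum s m v v \<ge> s 0"
proof -
  have "s 0 * nb_walks 0 v v \<le> (\<Sum>k\<le>m. s k * nb_walks k v v)"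
    using assms nb_walks_nonneg by (intro member_le_sum) auto
  then show ?thesis by (simp add: walk_sum_def)
qed

lemma adjacency_walk_sum_ge:
  assumes "v < n" and nonneg: "\<And>k. k \<le> m \<Longrightarrow> s k \<ge> 0" and "s (Suc m) = 0"
    and "real d * s 1 \<ge> \<rho> * s 0"
    and "\<And>k. 1 \<le> k \<Longrightarrow> k \<le> m \<Longrightarrow> s (k - 1) + (real d - 1) * s (k + 1) \<ge> \<rho> * s k"
  shows "(\<Sum>x\<in>N v. walk_sum s m x w) \<ge> \<rho> * walk_sum s m v w"
proof -
  have "\<rho> * walk_sum s m v w = \<rho> * s 0 * nb_walks 0 v w + (\<Sum>k=1..m. \<rho> * s k * nb_walks k v w)"
    unfolding walk_sum_def
    by (simp add: atMost_atLeast0 sum.atLeast_Suc_atMost sum_distrib_left algebra_simps del: nb_walks.simps)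
  also have "\<dots> \<le> real d * s 1 * nb_walks 0 v w +
    (\<Sum>k=1..m. (s (k - 1) + (real d - 1) * s (k + 1)) * nb_walks k v w)"
    using assms nb_walks_nonneg by (intro add_mono sum_mono mult_right_mono) auto
  \<comment> \<open>The boundary term of length \<open>m + 1\<close> is nonnegative; the one of
    length \<open>m + 2\<close> vanishes with \<open>s (Suc m)\<close>.\<close>
  also have "\<dots> \<le> real d * s 1 * nb_walks 0 v w +
    (\<Sum>k=1..m. (s (k - 1) + (real d - 1) * s (k + 1)) * nb_walks k v w) + s m * nb_walks (m + 1) v w"
    using nonneg[of m] nb_walks_nonneg[of "m + 1" v w] by (simp del: nb_walks.simps)
  also have "\<dots> = (\<Sum>x\<in>N v. walk_sum s (Suc m) x w)"
    using sum_walk_sum[OF assms(1), of s m w] assms(3) by simp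
  also have "\<dots> = (\<Sum>x\<in>N v. walk_sum s m x w)"
    using assms(3) by (simp add: walk_sum_Suc del: nb_walks.simps)
  finally show ?thesis .
qed

end

section \<open>Trigonometric weights\<close>

text \<open>For \<open>d \<ge> 2\<close> and \<open>r = sqrt (d - 1)\<close>, the weights are \<open>sin ((k + 1) \<phi>) / r ^ k\<close> with \<open>(m + 2) \<phi> = \<pi>\<close>: they
  solve the recurrence exactly, with \<open>\<rho> = 2 r cos \<phi>\<close>, and are positive up to their first zero \<open>k = m + 1\<close>.
  For \<open>d = 0\<close> the bound is \<open>-2\<close>, as \<open>sqrt (- 1) = - 1\<close> here.\<close>

lemma exists_walk_weights:
  fixes \<mu> :: real
  assumes "\<mu> < 2 * sqrt (real d - 1)"
  shows "\<exists>\<rho> s m. \<rho> > \<mu> \<and> (\<forall>k\<le>m. s k \<ge> 0) \<and> s 0 > 0 \<and> s (Suc m) = 0 \<and>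
    real d * s 1 \<ge> \<rho> * s 0 \<and>
    (\<forall>k. 1 \<le> k \<and> k \<le> m \<longrightarrow> s (k - 1) + (real d - 1) * s (k + 1) \<ge> \<rho> * s k)"
proof (cases "d \<le> 1")
  case True
  then have "2 * sqrt (real d - 1) \<le> 0" by simp
  \<comment> \<open>With \<open>m = 0\<close> and \<open>s 1 = 0\<close> the conditions on \<rho>
    reduce to \<rho> \<le> 0.\<close>
  with assms show ?thesis
    by (intro exI[of _ "2 * sqrt (real d - 1)"] exI[of _ "\<lambda>k::nat. of_bool (k = 0)"] exI[of _ 0]) auto
next
  case False
  define r where "r = sqrt (real d - 1)"
  have r: "r > 0" "r ^ 2 = real d - 1" using False by (auto simp: r_def)
  have "(\<lambda>m. 2 * r * cos (pi / real (m + 2))) \<longlonglongrightarrow> 2 * r * cos 0"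
  proof (intro tendsto_intros)
    have "(\<lambda>m. pi * inverse (real (m + 2))) \<longlonglongrightarrow> pi * 0"
      by (intro tendsto_intros LIMSEQ_ignore_initial_segment[OF lim_inverse_n])
    then show "(\<lambda>m. pi / real (m + 2)) \<longlonglongrightarrow> 0" by (simp add: field_simps)
  qed
  moreover have "\<mu> < 2 * r * cos 0" using assms by (simp add: r_def)
  ultimately obtain m where m: "\<mu> < 2 * r * cos (pi / real (m + 2))"
    using order_tendstoD(1) eventually_sequentially by (metis (no_types, lifting) order_refl)
  define \<phi> where "\<phi> = pi / real (m + 2)"
  have \<phi>: "\<phi> > 0" "real (m + 2) * \<phi> = pi" by (auto simp: \<phi>_def)
  define s where "s k = sin (real (k + 1) * \<phi>) / r ^ k" for k
  have s_pos: "s k > 0" if "k \<le> m" for k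
  proof -
    have "real (k + 1) * \<phi> < real (m + 2) * \<phi>"
      using that \<phi>(1) by (intro mult_strict_right_mono) auto
    then have "real (k + 1) * \<phi> < pi" unfolding \<phi>(2) .
    then have "sin (real (k + 1) * \<phi>) > 0" using \<phi> by (intro sin_gt_zero) auto
    then show ?thesis using r by (simp add: s_def)
  qed
  have s_end: "s (Suc m) = 0" using \<phi> by (simp add: s_def add.commute)
  have step: "s k + r ^ 2 * s (k + 2) = 2 * r * cos \<phi> * s (k + 1)" for k
  proof -
    define x where "x = real (k + 2) * \<phi>"
    have "sin (real (k + 1) * \<phi>) = sin (x - \<phi>)" "sin (real (k + 3) * \<phi>) = sin (x + \<phi>)"
      by (simp_all add: x_def algebra_simps)
    then have "sin (real (k + 1) * \<phi>) + sin (real (k + 3) * \<phi>) = 2 * cos \<phi> * sin x"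
      by (simp add: sin_add sin_diff)
    then show ?thesis using r(1)
      by (simp add: s_def x_def field_simps power2_eq_square numeral_3_eq_3)
  qed
  have start: "real d * s 1 \<ge> 2 * r * cos \<phi> * s 0"
  proof -
    have "(real d - 1) * s 1 = 2 * r * cos \<phi> * s 0"
      using r(1) sin_double[of \<phi>] by (simp add: s_def r(2)[symmetric] power2_eq_square field_simps)
    \<comment> \<open>The double angle formula gives equality with \<open>d - 1\<close>; this sign
      permits the passage to \<open>d\<close>. For \<open>m = 0\<close> the weight
      \<open>s 1\<close> is already the final zero.\<close>
    moreover have "s 1 \<ge> 0" using s_pos[of 1] s_end by (cases m) auto
    ultimately show ?thesis by (simp add: algebra_simps)
  qed
  have "s (k - 1) + (real d - 1) * s (k + 1) \<ge> 2 * r * cos \<phi> * s k" if "1 \<le> k" for k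
    using step[of "k - 1"] that r(2) by simp
  with m s_pos s_end start show ?thesis unfolding \<phi>_def[symmetric]
    by (intro exI[of _ "2 * r * cos \<phi>"] exI[of _ s] exI[of _ m]) (auto intro: less_imp_le)
qed

section \<open>Traces and simultaneous triangular form\<close>

lemma trace_mult_commute:
  fixes X Y :: "'a :: comm_ring_1 mat"
  assumes "X \<in> carrier_mat n m" "Y \<in> carrier_mat m n"
  shows "(\<Sum>i<n. (X * Y) $$ (i, i)) = (\<Sum>i<m. (Y * X) $$ (i, i))"
proof -
  have "(\<Sum>i<n. (X * Y) $$ (i, i)) = (\<Sum>i<n. \<Sum>j<m. X $$ (i, j) * Y $$ (j, i))"
    using assms by (simp add: scalar_prod_def lessThan_atLeast0)
  also have "\<dots> = (\<Sum>j<m. \<Sum>i<n. Y $$ (j, i) * X $$ (i, j))"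
    by (subst sum.swap) (simp add: mult.commute)
  also have "\<dots> = (\<Sum>i<m. (Y * X) $$ (i, i))"
    using assms by (simp add: scalar_prod_def lessThan_atLeast0)
  finally show ?thesis .
qed

lemma upper_triangular_mult_diagonal:
  fixes S T :: "'a :: comm_ring_1 mat"
  assumes "S \<in> carrier_mat n n" "T \<in> carrier_mat n n" "upper_triangular S" "upper_triangular T"
  shows "upper_triangular (S * T)" "i < n \<Longrightarrow> (S * T) $$ (i, i) = S $$ (i, i) * T $$ (i, i)"
proof -
  have entry: "(S * T) $$ (i, j) = (\<Sum>l<n. S $$ (i, l) * T $$ (l, j))" if "i < n" "j < n" for i j
    using assms that by (simp add: scalar_prod_def lessThan_atLeast0)
  \<comment> \<open>On or below the diagonal a product can be nonzero only if i \<le> l \<le> j,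
    which together with j \<le> i forces all three indices to coincide.\<close>
  have zero: "S $$ (i, l) * T $$ (l, j) = 0" if "i < n" "l < n" "j \<le> i" "\<not> (l = i \<and> j = i)" for i j l
  proof (cases "l < i")
    case True
    then show ?thesis using upper_triangularD[OF assms(3), of l i] assms(1) that by auto
  next
    case False
    then have "j < l" using that by auto
    then show ?thesis using upper_triangularD[OF assms(4), of j l] assms(2) that by auto
  qed
  show "upper_triangular (S * T)"
  proof (intro upper_triangularI)
    fix i j assume "j < i" "i < dim_row (S * T)"
    then have "i < n" "j < n" using assms by auto
    then show "(S * T) $$ (i, j) = 0"
      using \<open>j < i\<close> unfolding entry[OF \<open>i < n\<close> \<open>j < n\<close>] by (intro sum.neutral ballI zero) auto
  qed
  show "(S * T) $$ (i, i) = S $$ (i, i) * T $$ (i, i)" if "i < n"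
  proof -
    have "(\<Sum>l<n. S $$ (i, l) * T $$ (l, i)) = (\<Sum>l\<in>{i}. S $$ (i, l) * T $$ (l, i))"
      using that by (intro sum.mono_neutral_right) (auto intro!: zero)
    then show ?thesis using entry that by simp
  qed
qed

locale change_of_basis =
  fixes n :: nat and P Q :: "complex mat"
  assumes P_carrier: "P \<in> carrier_mat n n" and Q_carrier: "Q \<in> carrier_mat n n"
    and PQ: "P * Q = 1\<^sub>m n" and QP: "Q * P = 1\<^sub>m n"
begin

text \<open>Here \<open>f\<close> lists the diagonal of \<open>M\<close> in the new basis. Since
  this is compatible with sums, scalar multiples and products, the trace of a polynomial in one
  triangularised matrix can be read off its eigenvalues, without diagonalising it.\<close>

definition triangular_as :: "complex mat \<Rightarrow> (nat \<Rightarrow> complex) \<Rightarrow> bool" where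
  "triangular_as M f \<longleftrightarrow> M \<in> carrier_mat n n \<and> upper_triangular (Q * M * P) \<and>
     (\<forall>i<n. (Q * M * P) $$ (i, i) = f i)"

lemma triangular_as_one: "triangular_as (1\<^sub>m n) (\<lambda>_. 1)"
  using P_carrier Q_carrier QP by (auto simp: triangular_as_def)

lemma triangular_as_add:
  assumes "triangular_as M f" "triangular_as M' f'"
  shows "triangular_as (M + M') (\<lambda>i. f i + f' i)"
proof -
  have M: "M \<in> carrier_mat n n" "M' \<in> carrier_mat n n" using assms by (auto simp: triangular_as_def)
  have "Q * (M + M') * P = (Q * M + Q * M') * P"
    using mult_add_distrib_mat[OF Q_carrier M] by simp
  also have "\<dots> = Q * M * P + Q * M' * P"
    using M P_carrier Q_carrier by (intro add_mult_distrib_mat) auto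
  finally have "Q * (M + M') * P = Q * M * P + Q * M' * P" .
  then show ?thesis using assms P_carrier Q_carrier
    by (auto simp: triangular_as_def upper_triangular_def)
qed

lemma triangular_as_smult:
  assumes "triangular_as M f"
  shows "triangular_as (c \<cdot>\<^sub>m M) (\<lambda>i. c * f i)"
proof -
  have M: "M \<in> carrier_mat n n" using assms by (auto simp: triangular_as_def)
  have "Q * (c \<cdot>\<^sub>m M) * P = (c \<cdot>\<^sub>m (Q * M)) * P"
    using mult_smult_distrib[OF Q_carrier M] by simp
  also have "\<dots> = c \<cdot>\<^sub>m (Q * M * P)"
    using M P_carrier Q_carrier by (intro mult_smult_assoc_mat) auto
  finally have "Q * (c \<cdot>\<^sub>m M) * P = c \<cdot>\<^sub>m (Q * M * P)" .
  then show ?thesis using assms P_carrier Q_carrier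
    by (auto simp: triangular_as_def upper_triangular_def)
qed

lemma triangular_as_mult:
  assumes "triangular_as M f" "triangular_as M' f'"
  shows "triangular_as (M * M') (\<lambda>i. f i * f' i)"
proof -
  have M: "M \<in> carrier_mat n n" "M' \<in> carrier_mat n n" using assms by (auto simp: triangular_as_def)
  have "Q * M * P * (Q * M' * P) = Q * M * (P * Q) * (M' * P)"
    using M P_carrier Q_carrier by (simp add: assoc_mult_mat[of _ n n _ n _ n])
  also have "\<dots> = Q * (M * M') * P"
    using M P_carrier Q_carrier unfolding PQ by (simp add: assoc_mult_mat[of _ n n _ n _ n])
  finally show ?thesis
    using assms M P_carrier Q_carrier
      upper_triangular_mult_diagonal[of "Q * M * P" n "Q * M' * P"]
    by (auto simp: triangular_as_def)
qed

lemma trace_triangular_as: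
  assumes "triangular_as M f"
  shows "(\<Sum>i<n. M $$ (i, i)) = (\<Sum>i<n. f i)"
proof -
  have M: "M \<in> carrier_mat n n" using assms by (auto simp: triangular_as_def)
  have "(\<Sum>i<n. f i) = (\<Sum>i<n. (Q * M * P) $$ (i, i))"
    using assms by (auto simp: triangular_as_def)
  also have "\<dots> = (\<Sum>i<n. (P * (Q * M)) $$ (i, i))"
    using M P_carrier Q_carrier by (intro trace_mult_commute) auto
  also have "P * (Q * M) = M"
    using M P_carrier Q_carrier PQ by (simp flip: assoc_mult_mat[of _ n n _ n _ n])
  finally show ?thesis by simp
qed

end

section \<open>Walk polynomials and sums over a spectrum\<close>

text \<open>The recursion satisfied by the matrices of non-backtracking walks, read in one variable.\<close>

fun nb_poly :: "nat \<Rightarrow> nat \<Rightarrow> real \<Rightarrow> real" where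
  "nb_poly d 0 x = 1"
| "nb_poly d (Suc 0) x = x"
| "nb_poly d (Suc (Suc 0)) x = x * x - real d"
| "nb_poly d (Suc (Suc (Suc k))) x =
     x * nb_poly d (Suc (Suc k)) x - (real d - 1) * nb_poly d (Suc k) x"

lemma isCont_nb_poly: "isCont (nb_poly d k) x"
proof (induction d k x rule: nb_poly.induct)
  case (4 d k x)
  have "isCont (\<lambda>x. x * nb_poly d (Suc (Suc k)) x - (real d - 1) * nb_poly d (Suc k) x) x"
    by (intro continuous_intros 4)
  then show ?case by simp
qed simp_all

text \<open>In decreasing order every entry from the second on is at most \<mu> and contributes
  nothing positive, so the first entry alone has to be bounded by \<open>C\<close>.\<close>

lemma second_entry_sum_le:
  fixes g :: "real \<Rightarrow> real" and xs :: "real list"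
  assumes "length xs \<ge> 2" "rev (sort xs) ! 1 \<le> \<mu>"
    and "\<And>x. x \<le> \<mu> \<Longrightarrow> g x \<le> 0" and "\<And>x. x \<in> set xs \<Longrightarrow> g x \<le> C"
  shows "(\<Sum>x\<leftarrow>xs. g x) \<le> C"
proof -
  define ys where "ys = rev (sort xs)"
  have ys: "mset ys = mset xs" "sorted (rev ys)" by (simp_all add: ys_def)
  then have "length ys \<ge> 2" using assms(1) by (metis size_mset)
  then obtain a b zs where abz: "ys = a # b # zs"
    by (metis One_nat_def Suc_1 Suc_le_length_iff)
  have "b \<le> \<mu>" using assms(2) abz by (simp flip: ys_def)
  moreover have "z \<le> b" if "z \<in> set zs" for z
    using ys(2) that unfolding abz by (auto simp: sorted_append)
  ultimately have "(\<Sum>x\<leftarrow>b # zs. g x) \<le> (\<Sum>x\<leftarrow>b # zs. 0)"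
    using assms(3) by (intro sum_list_mono) fastforce
  moreover have "a \<in> set xs" using ys(1) abz by (metis list.set_intros(1) mset_eq_setD)
  ultimately have "(\<Sum>x\<leftarrow>ys. g x) \<le> C" using assms(4)[of a] abz by simp
  moreover have "(\<Sum>x\<leftarrow>xs. g x) = (\<Sum>x\<leftarrow>ys. g x)"
    using ys(1) by (metis mset_map sum_mset_sum_list)
  ultimately show ?thesis by simp
qed

text \<open>Matches the multiset of roots behind \<open>eigenvalues_decreasing\<close> with the list
  of diagonal entries in a Schur decomposition, multiplicities included.\<close>

lemma proots_prod_linear: "proots (\<Prod>e\<leftarrow>es. [:- e, 1:]) = mset (es :: complex list)"
proof (induction es)
  case (Cons e es)
  have "(\<Prod>e\<leftarrow>es. [:- e, 1:]) \<noteq> (0 :: complex poly)" by (auto simp: prod_list_zero_iff)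
  then show ?case using Cons proots_mult[of "[:- e, 1:]" "\<Prod>e\<leftarrow>es. [:- e, 1:]"]
    by (simp del: mult_pCons_left)
qed simp

section \<open>Spectrum of the adjacency matrix and the trace inequality\<close>

context regular_graph
begin

definition rmat :: "(nat \<Rightarrow> nat \<Rightarrow> real) \<Rightarrow> complex mat" where
  "rmat F = mat n n (\<lambda>(i, j). complex_of_real (F i j))"

definition adjacency :: "complex mat" where
  "adjacency = mat n n (\<lambda>(i, j). of_bool (j \<in> N i))"

lemma adjacency_carrier: "adjacency \<in> carrier_mat n n"
  by (simp add: adjacency_def)

lemma adjacency_row_sum:
  assumes "i < n"
  shows "(\<Sum>j<n. adjacency $$ (i, j) * f j) = (\<Sum>j\<in>N i. f j)"
proof -
  have "(\<Sum>j<n. adjacency $$ (i, j) * f j) = (\<Sum>j<n. if j \<in> N i then f j else 0)"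
    using assms by (intro sum.cong) (auto simp: adjacency_def)
  also have "\<dots> = (\<Sum>j\<in>{..<n} \<inter> N i. f j)" by (simp add: sum.inter_restrict)
  also have "{..<n} \<inter> N i = N i" using N_sub[OF assms] by auto
  finally show ?thesis .
qed

lemma adjacency_mult_rmat: "adjacency * rmat F = rmat (\<lambda>i j. \<Sum>l\<in>N i. F l j)"
proof (rule eq_matI)
  fix i j assume "i < dim_row (rmat (\<lambda>i j. \<Sum>l\<in>N i. F l j))" "j < dim_col (rmat (\<lambda>i j. \<Sum>l\<in>N i. F l j))"
  then have ij: "i < n" "j < n" by (auto simp: rmat_def)
  have "(adjacency * rmat F) $$ (i, j) = (\<Sum>l<n. adjacency $$ (i, l) * of_real (F l j))"
    using ij by (simp add: rmat_def adjacency_def scalar_prod_def lessThan_atLeast0)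
  also have "\<dots> = of_real (\<Sum>l\<in>N i. F l j)"
    using adjacency_row_sum[OF ij(1), of "\<lambda>l. of_real (F l j)"] by simp
  finally show "(adjacency * rmat F) $$ (i, j) = rmat (\<lambda>i j. \<Sum>l\<in>N i. F l j) $$ (i, j)"
    using ij by (simp add: rmat_def)
qed (auto simp: rmat_def adjacency_def)

text \<open>For reality, the Hermitian form \<open>q\<close> of the eigenvector equals
  \<open>e\<close> times its squared norm and is self-conjugate because adjacency is symmetric. For
  the bound, the eigenvalue equation is read at an entry of largest modulus, where the right side is
  a sum of \<open>d\<close> entries.\<close>

lemma adjacency_eigenvalue:
  assumes "eigenvalue adjacency e"
  shows "e \<in> \<real>" "cmod e \<le> real d"
proof -
  obtain v where "eigenvector adjacency v e" using assms by (auto simp: eigenvalue_def)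
  then have v: "v \<in> carrier_vec n" "v \<noteq> 0\<^sub>v n" "adjacency *\<^sub>v v = e \<cdot>\<^sub>v v"
    by (auto simp: eigenvector_def adjacency_def)
  have eq: "(\<Sum>j\<in>N i. v $ j) = e * v $ i" if "i < n" for i
  proof -
    have "(adjacency *\<^sub>v v) $ i = (\<Sum>j<n. adjacency $$ (i, j) * v $ j)"
      using that v(1) by (simp add: adjacency_def scalar_prod_def lessThan_atLeast0)
    then show ?thesis using that v adjacency_row_sum[OF that] by simp
  qed
  obtain i0 where i0: "i0 < n" "v $ i0 \<noteq> 0" using v by (metis carrier_vecD eq_vecI index_zero_vec)
  define nrm where "nrm = (\<Sum>i<n. (cmod (v $ i))\<^sup>2)"
  have "nrm > 0" unfolding nrm_def using i0 by (intro sum_pos2[of _ i0]) auto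
  define q where "q = (\<Sum>i<n. \<Sum>j<n. of_bool (j \<in> N i) * (cnj (v $ i) * v $ j))"
  have "q = (\<Sum>i<n. cnj (v $ i) * (\<Sum>j\<in>N i. v $ j))"
    unfolding q_def
  proof (intro sum.cong refl)
    fix i assume "i \<in> {..<n}"
    then have "(\<Sum>j<n. adjacency $$ (i, j) * (cnj (v $ i) * v $ j)) = (\<Sum>j\<in>N i. cnj (v $ i) * v $ j)"
      by (intro adjacency_row_sum) auto
    then show "(\<Sum>j<n. of_bool (j \<in> N i) * (cnj (v $ i) * v $ j)) = cnj (v $ i) * (\<Sum>j\<in>N i. v $ j)"
      using \<open>i \<in> {..<n}\<close> by (simp add: adjacency_def sum_distrib_left)
  qed
  also have "\<dots> = (\<Sum>i<n. e * of_real ((cmod (v $ i))\<^sup>2))"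
    by (intro sum.cong refl) (simp add: eq complex_norm_square mult_ac del: of_real_power)
  finally have q: "q = e * of_real nrm" by (simp add: nrm_def sum_distrib_left)
  have "cnj q = q"
    unfolding q_def cnj_sum
  proof (subst sum.swap, intro sum.cong refl)
    fix i j assume "i \<in> {..<n}" "j \<in> {..<n}"
    then have "i \<in> N j \<longleftrightarrow> j \<in> N i" using N_sym by blast
    then show "cnj (of_bool (i \<in> N j) * (cnj (v $ j) * v $ i)) = of_bool (j \<in> N i) * (cnj (v $ i) * v $ j)"
      by simp
  qed
  then have "e = cnj e" using q \<open>nrm > 0\<close> by simp
  then show "e \<in> \<real>" by (simp add: Reals_cnj_iff)
  define c where "c = Max ((\<lambda>i. cmod (v $ i)) ` {..<n})"
  have "c \<in> (\<lambda>i. cmod (v $ i)) ` {..<n}" unfolding c_def using i0(1) by (intro Max_in) auto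
  moreover have "cmod (v $ j) \<le> c" if "j < n" for j unfolding c_def using that by (intro Max_ge) auto
  ultimately obtain i where i: "i < n" "\<And>j. j < n \<Longrightarrow> cmod (v $ j) \<le> cmod (v $ i)" by auto
  have "cmod e * cmod (v $ i) = cmod (\<Sum>j\<in>N i. v $ j)" using eq[OF i(1)] by (simp add: norm_mult)
  also have "\<dots> \<le> real (card (N i)) * cmod (v $ i)"
    using i N_less by (intro sum_norm_bound) auto
  finally have "cmod e * cmod (v $ i) \<le> real d * cmod (v $ i)" using N_card i(1) by simp
  moreover have "cmod (v $ i) > 0" using i(2)[OF i0(1)] i0(2) by (smt (verit) zero_less_norm_iff)
  ultimately show "cmod e \<le> real d" by simp
qed

lemma rmat_cong: "(\<And>i j. i < n \<Longrightarrow> j < n \<Longrightarrow> F i j = G i j) \<Longrightarrow> rmat F = rmat G"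
  by (auto simp: rmat_def intro!: cong_mat)

lemma rmat_add: "rmat (\<lambda>i j. F i j + G i j) = rmat F + rmat G"
  and rmat_smult: "rmat (\<lambda>i j. c * F i j) = complex_of_real c \<cdot>\<^sub>m rmat F"
  by (auto simp: rmat_def intro!: eq_matI)

lemma rmat_nb_walks_0: "rmat (nb_walks 0) = 1\<^sub>m n"
  by (auto simp: rmat_def intro!: eq_matI)

lemma rmat_nb_walks_1: "rmat (nb_walks 1) = adjacency * rmat (nb_walks 0)"
  unfolding adjacency_mult_rmat by (intro rmat_cong) (simp only: sum_nb_walks_0)

lemma rmat_nb_walks_2:
  "rmat (nb_walks 2) = adjacency * rmat (nb_walks 1) + complex_of_real (- real d) \<cdot>\<^sub>m rmat (nb_walks 0)"
  unfolding adjacency_mult_rmat rmat_smult[symmetric] rmat_add[symmetric]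
  using sum_nb_walks_1 by (intro rmat_cong) (simp del: nb_walks.simps One_nat_def)

lemma rmat_nb_walks_Suc_Suc_Suc:
  "rmat (nb_walks (k + 3)) = adjacency * rmat (nb_walks (k + 2))
     + complex_of_real (- (real d - 1)) \<cdot>\<^sub>m rmat (nb_walks (k + 1))"
  unfolding adjacency_mult_rmat rmat_smult[symmetric] rmat_add[symmetric]
  by (intro rmat_cong) (simp only: sum_nb_walks_Suc_Suc mult_minus_left
        diff_conv_add_uminus[symmetric] add_diff_cancel_right')

lemma trace_rmat_mult:
  "(\<Sum>i<n. (rmat F * rmat G) $$ (i, i)) = of_real (\<Sum>i<n. \<Sum>j<n. F i j * G j i)"
  by (simp add: rmat_def scalar_prod_def lessThan_atLeast0)

text \<open>The recurrences build each walk matrix from \<open>adjacency\<close> by operations that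
  preserve \<open>triangular_as\<close>. Lengths 0, 1 and 2 are separate base cases, as the
  coefficient at length 2 is \<open>d\<close> instead of \<open>d - 1\<close>.\<close>

lemma triangular_as_nb_walks:
  fixes r :: "nat \<Rightarrow> real"
  assumes "change_of_basis n P Q"
    and adj: "change_of_basis.triangular_as n P Q adjacency (\<lambda>i. of_real (r i))"
  shows "change_of_basis.triangular_as n P Q (rmat (nb_walks k)) (\<lambda>i. of_real (nb_poly d k (r i)))"
proof -
  interpret change_of_basis n P Q by fact
  have 0: "triangular_as (rmat (nb_walks 0)) (\<lambda>i. of_real (nb_poly d 0 (r i)))"
    using triangular_as_one by (simp add: rmat_nb_walks_0)
  have 1: "triangular_as (rmat (nb_walks 1)) (\<lambda>i. of_real (nb_poly d 1 (r i)))"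
    using triangular_as_mult[OF adj 0] unfolding rmat_nb_walks_1 by simp
  have 2: "triangular_as (rmat (nb_walks 2)) (\<lambda>i. of_real (nb_poly d 2 (r i)))"
    using triangular_as_add[OF triangular_as_mult[OF adj 1] triangular_as_smult[OF 0, of "of_real (- real d)"]]
    unfolding rmat_nb_walks_2 by (simp add: numeral_2_eq_2)
  show ?thesis
  proof (induction k rule: less_induct)
    case (less k)
    have "k = 0 \<or> k = 1 \<or> k = 2 \<or> k = (k - 3) + 3" by arith
    then consider "k = 0" | "k = 1" | "k = 2" | l where "k = l + 3" by blast
    then show ?case
    proof cases
      case 4
      have "triangular_as (rmat (nb_walks (l + 2))) (\<lambda>i. of_real (nb_poly d (l + 2) (r i)))"
        "triangular_as (rmat (nb_walks (l + 1))) (\<lambda>i. of_real (nb_poly d (l + 1) (r i)))"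
        using less 4 by simp_all
      from triangular_as_add[OF triangular_as_mult[OF adj this(1)]
          triangular_as_smult[OF this(2), of "of_real (- (real d - 1))"]]
      show ?thesis unfolding 4 rmat_nb_walks_Suc_Suc_Suc by (simp add: numeral_3_eq_3 algebra_simps)
    qed (use 0 1 2 in \<open>simp_all only:\<close>)
  qed
qed

lemma triangular_as_walk_sum:
  fixes r :: "nat \<Rightarrow> real"
  assumes "change_of_basis n P Q"
    and adj: "change_of_basis.triangular_as n P Q adjacency (\<lambda>i. of_real (r i))"
  shows "change_of_basis.triangular_as n P Q (rmat (walk_sum s m))
    (\<lambda>i. of_real (\<Sum>k\<le>m. s k * nb_poly d k (r i)))"
proof -
  interpret change_of_basis n P Q by fact
  have step: "triangular_as (rmat (\<lambda>i j. s k * nb_walks k i j)) (\<lambda>i. of_real (s k * nb_poly d k (r i)))" for k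
    using triangular_as_smult[OF triangular_as_nb_walks[OF assms, of k], of "of_real (s k)"]
    by (simp add: rmat_smult)
  show ?thesis
  proof (induction m)
    case 0
    show ?case using step[of 0] by (simp add: walk_sum_0[abs_def] del: nb_walks.simps)
  next
    case (Suc m)
    have "rmat (walk_sum s (Suc m)) = rmat (walk_sum s m) + rmat (\<lambda>i j. s (Suc m) * nb_walks (Suc m) i j)"
      unfolding rmat_add[symmetric] by (intro rmat_cong) (simp only: walk_sum_Suc)
    then show ?case using triangular_as_add[OF Suc.IH step[of "Suc m"]] by simp
  qed
qed

text \<open>A Schur form suffices for traces, and its diagonal can be prescribed as the list of
  roots of the characteristic polynomial. The same list \<open>rs\<close> thus serves both the trace
  and the ordered eigenvalues.\<close>

lemma adjacency_spectrum:
  obtains rs P Q where "length rs = n" "change_of_basis n P Q"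
    "change_of_basis.triangular_as n P Q adjacency (\<lambda>i. of_real (rs ! i))"
    "\<And>x. x \<in> set rs \<Longrightarrow> \<bar>x\<bar> \<le> real d"
    "eigenvalues_decreasing adjacency = rev (sort rs)"
proof -
  obtain es where es: "char_poly adjacency = (\<Prod>e\<leftarrow>es. [:- e, 1:])" "length es = n"
    using char_poly_factorized[OF adjacency_carrier] by blast
  have ev: "eigenvalue adjacency e" if "e \<in> set es" for e
    using that by (auto simp: eigenvalue_root_char_poly[OF adjacency_carrier] es poly_prod_list
        prod_list_zero_iff image_iff)
  \<comment> \<open>All eigenvalues are real, so taking \<open>Re\<close> loses nothing.\<close>
  have es_real: "map (of_real \<circ> Re) es = es"
    using adjacency_eigenvalue(1)[OF ev] by (intro map_idI) (simp add: of_real_Re)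
  obtain T P Q where TPQ: "schur_decomposition adjacency es = (T, P, Q)" by (metis prod_cases3)
  have schur: "similar_mat_wit adjacency T P Q" "upper_triangular T" "diag_mat T = es"
    using schur_decomposition[OF adjacency_carrier es(1) TPQ] by auto
  note wit = similar_mat_witD2[OF adjacency_carrier schur(1)]
  have cb: "change_of_basis n P Q" using wit by unfold_locales auto
  interpret change_of_basis n P Q by fact
  have "Q * adjacency * P = Q * P * (T * (Q * P))"
    unfolding wit(3) using wit(4-7) by (simp add: assoc_mult_mat[of _ n n _ n _ n])
  then have "Q * adjacency * P = T" using wit(4-7) by (simp add: wit(2))
  moreover have "T $$ (i, i) = es ! i" if "i < n" for i
    using schur(3) wit(5) that by (auto simp: diag_mat_def)
  moreover have "of_real (Re (es ! i)) = es ! i" if "i < n" for i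
    using arg_cong[OF es_real, of "\<lambda>xs. xs ! i"] that es(2) by simp
  ultimately have tri: "triangular_as adjacency (\<lambda>i. of_real (map Re es ! i))"
    using schur(2) es(2) by (auto simp: triangular_as_def adjacency_carrier simp del: index_mult_mat)
  have abs: "\<bar>x\<bar> \<le> real d" if "x \<in> set (map Re es)" for x
    using that adjacency_eigenvalue(2)[OF ev] abs_Re_le_cmod order_trans by fastforce
  have "eigenvalues_decreasing adjacency = rev (sort (map Re es))"
    by (simp add: eigenvalues_decreasing_def es(1) proots_prod_linear flip: mset_map)
  then show ?thesis using that[OF _ cb tri abs] es(2) by simp
qed

text \<open>\<open>C\<close> bounds the spectral term on all of \<open>[-d, d]\<close>, not just at
  the actual largest eigenvalue, so it can be chosen without knowing the graph; the conclusion then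
  caps \<open>n\<close>.\<close>

lemma order_le_of_second_largest_le:
  assumes "n \<ge> 2" "second_largest_eigenvalue adjacency \<le> \<mu>" "\<mu> \<le> \<rho>"
    and nonneg: "\<And>k. k \<le> m \<Longrightarrow> s k \<ge> 0" and "s (Suc m) = 0"
    and "real d * s 1 \<ge> \<rho> * s 0"
    and "\<And>k. 1 \<le> k \<Longrightarrow> k \<le> m \<Longrightarrow> s (k - 1) + (real d - 1) * s (k + 1) \<ge> \<rho> * s k"
    and bound: "\<And>x. \<bar>x\<bar> \<le> real d \<Longrightarrow> (x - \<mu>) * (\<Sum>k\<le>m. s k * nb_poly d k x)\<^sup>2 \<le> C"
  shows "(\<rho> - \<mu>) * (s 0)\<^sup>2 * real n \<le> C"
proof -
  obtain rs P Q where rs: "length rs = n" "change_of_basis n P Q"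
    "change_of_basis.triangular_as n P Q adjacency (\<lambda>i. of_real (rs ! i))"
    "\<And>x. x \<in> set rs \<Longrightarrow> \<bar>x\<bar> \<le> real d"
    "eigenvalues_decreasing adjacency = rev (sort rs)"
    using adjacency_spectrum by blast
  interpret change_of_basis n P Q by fact
  define H where "H = walk_sum s m"
  define h where "h x = (\<Sum>k\<le>m. s k * nb_poly d k x)" for x
  define AH where "AH i j = (\<Sum>l\<in>N i. H l j)" for i j
  have H: "triangular_as (rmat H) (\<lambda>i. of_real (h (rs ! i)))"
    using triangular_as_walk_sum[OF rs(2,3)] by (simp add: H_def h_def)
  have AH: "rmat (\<lambda>i j. AH i j + (- \<mu>) * H i j) =
      adjacency * rmat H + of_real (- \<mu>) \<cdot>\<^sub>m rmat H"
    by (simp only: rmat_add rmat_smult adjacency_mult_rmat AH_def)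
  have "triangular_as (rmat (\<lambda>i j. AH i j + (- \<mu>) * H i j) * rmat H)
      (\<lambda>i. (of_real (rs ! i) * of_real (h (rs ! i)) + of_real (- \<mu>) * of_real (h (rs ! i)))
             * of_real (h (rs ! i)))"
    unfolding AH by (intro triangular_as_mult triangular_as_add triangular_as_smult rs(3) H)
  from trace_triangular_as[OF this, unfolded trace_rmat_mult]
  have "complex_of_real (\<Sum>i<n. \<Sum>j<n. (AH i j + (- \<mu>) * H i j) * H j i) =
      of_real (\<Sum>i<n. (rs ! i - \<mu>) * (h (rs ! i))\<^sup>2)"
    by (simp add: power2_eq_square algebra_simps)
  then have trace: "(\<Sum>i<n. \<Sum>j<n. (AH i j - \<mu> * H i j) * H j i) = (\<Sum>i<n. (rs ! i - \<mu>) * (h (rs ! i))\<^sup>2)"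
    unfolding of_real_eq_iff by simp
  have H_nonneg: "H i j \<ge> 0" for i j using walk_sum_nonneg nonneg by (simp add: H_def)
  have entry: "(AH i j - \<mu> * H i j) * H j i \<ge> (\<rho> - \<mu>) * H i j * H j i" if "i < n" for i j
    using adjacency_walk_sum_ge[where v=i and w=j, OF that assms(4-7)] H_nonneg
    by (intro mult_right_mono) (auto simp: AH_def H_def algebra_simps)
  have "(\<rho> - \<mu>) * (s 0)\<^sup>2 * real n = (\<Sum>i<n. (\<rho> - \<mu>) * (s 0 * s 0))"
    by (simp add: power2_eq_square)
  also have "\<dots> \<le> (\<Sum>i<n. \<Sum>j<n. (AH i j - \<mu> * H i j) * H j i)"
  proof (intro sum_mono)
    fix i assume i: "i \<in> {..<n}"
    have "s 0 * s 0 \<le> H i i * H i i"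
      using walk_sum_diagonal[of m s i] nonneg by (intro mult_mono) (auto simp: H_def H_nonneg[unfolded H_def])
    then have "(\<rho> - \<mu>) * (s 0 * s 0) \<le> (\<rho> - \<mu>) * H i i * H i i"
      using mult_left_mono[of "s 0 * s 0" "H i i * H i i" "\<rho> - \<mu>"] assms(3) by (simp add: mult.assoc)
    \<comment> \<open>Only the summand \<open>j = i\<close> was present; the added ones are products
      of nonnegative numbers.\<close>
    also have "\<dots> \<le> (\<Sum>j<n. (\<rho> - \<mu>) * H i j * H j i)"
      using i H_nonneg assms(3) by (intro member_le_sum[of i "{..<n}" "\<lambda>j. (\<rho> - \<mu>) * H i j * H j i"]) auto
    also have "\<dots> \<le> (\<Sum>j<n. (AH i j - \<mu> * H i j) * H j i)"
      using entry i by (intro sum_mono) auto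
    finally show "(\<rho> - \<mu>) * (s 0 * s 0) \<le> (\<Sum>j<n. (AH i j - \<mu> * H i j) * H j i)" .
  qed
  also have "\<dots> = (\<Sum>x\<leftarrow>rs. (x - \<mu>) * (h x)\<^sup>2)"
    unfolding trace using rs(1) by (simp add: sum_list_sum_nth lessThan_atLeast0)
  also have "\<dots> \<le> C"
    using assms(1,2) rs(1,4,5) bound
    by (intro second_entry_sum_le[where \<mu>=\<mu>])
       (auto simp: second_largest_eigenvalue_def h_def intro!: mult_nonpos_nonneg)
  finally show ?thesis .
qed

end

section \<open>The Alon-Boppana bound for large regular graphs\<close>

lemma alon_boppana:
  fixes \<mu> :: real
  assumes "\<mu> < 2 * sqrt (real d - 1)"
  shows "\<exists>n0. \<forall>n\<ge>n0. \<forall>N. regular_graph n d N \<longrightarrow>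
    \<mu> < second_largest_eigenvalue (regular_graph.adjacency n N)"
proof -
  obtain \<rho> s m where w: "\<rho> > \<mu>" "\<forall>k\<le>m. s k \<ge> 0" "s 0 > 0" "s (Suc m) = 0"
    "real d * s 1 \<ge> \<rho> * s 0"
    "\<forall>k. 1 \<le> k \<and> k \<le> m \<longrightarrow> s (k - 1) + (real d - 1) * s (k + 1) \<ge> \<rho> * s k"
    using exists_walk_weights[OF assms] by blast
  \<comment> \<open>Continuity on a compact interval gives a \<open>C\<close> that depends on
    \<open>d\<close>, \<mu> and the weights, but not on the graph.\<close>
  have "\<exists>C. \<forall>x. - real d \<le> x \<and> x \<le> real d \<longrightarrow> (x - \<mu>) * (\<Sum>k\<le>m. s k * nb_poly d k x)\<^sup>2 \<le> C"
    by (intro isCont_bounded allI impI continuous_intros isCont_nb_poly) auto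
  then obtain C where C: "(x - \<mu>) * (\<Sum>k\<le>m. s k * nb_poly d k x)\<^sup>2 \<le> C" if "\<bar>x\<bar> \<le> real d" for x
    by (metis abs_le_iff minus_le_iff)
  obtain n0 where n0: "C / ((\<rho> - \<mu>) * (s 0)\<^sup>2) < real n0" using reals_Archimedean2 by blast
  show ?thesis
  \<comment> \<open>The 2 guarantees that a second eigenvalue exists.\<close>
  proof (intro exI[of _ "max 2 n0"] allI impI)
    fix n N assume n: "max 2 n0 \<le> n" and "regular_graph n d N"
    then interpret regular_graph n d N by simp
    show "\<mu> < second_largest_eigenvalue adjacency"
    proof (rule ccontr)
      assume "\<not> ?thesis"
      then have "(\<rho> - \<mu>) * (s 0)\<^sup>2 * real n \<le> C"
        using w C n by (intro order_le_of_second_largest_le[where m=m]) auto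
      moreover have "C < (\<rho> - \<mu>) * (s 0)\<^sup>2 * real n0"
        using n0 w by (simp add: divide_less_eq mult.commute)
      moreover have "(\<rho> - \<mu>) * (s 0)\<^sup>2 * real n0 \<le> (\<rho> - \<mu>) * (s 0)\<^sup>2 * real n"
        using n w by (intro mult_left_mono) auto
      ultimately show False by linarith
    qed
  qed
qed

section \<open>From evolution algebras to graphs\<close>

lemma regular_graph_evolution_graph:
  assumes "regular_evolution_algebra d E B"
  shows "regular_graph (length B) d (neighbours (evolution_graph E B))"
  using assms
  by unfold_locales (auto simp: regular_evolution_algebra_def neighbours_def evolution_graph_def insert_commute)

text \<open>Symmetry merges the two alternatives in the definition of an edge into one entry;
  graphicability makes that entry 0 or 1 and the diagonal zero.\<close>

lemma structural_matrix_eq_adjacency: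
  assumes "symmetric_evolution_algebra E B" "graphicable_evolution_algebra E B"
    "regular_evolution_algebra d E B"
  shows "structural_matrix E B = regular_graph.adjacency (length B) (neighbours (evolution_graph E B))"
proof -
  interpret regular_graph "length B" d "neighbours (evolution_graph E B)"
    using assms(3) by (rule regular_graph_evolution_graph)
  show ?thesis
  proof (rule eq_matI)
    fix i j assume "i < dim_row adjacency" "j < dim_col adjacency"
    then have ij: "i < length B" "j < length B" by (auto simp: adjacency_def)
    have "j \<in> neighbours (evolution_graph E B) i \<longleftrightarrow>
        i \<noteq> j \<and> (structural_matrix E B $$ (i, j) \<noteq> 0 \<or> structural_matrix E B $$ (j, i) \<noteq> 0)"
      using ij by (auto simp: neighbours_def evolution_graph_def doubleton_eq_iff)
    then show "structural_matrix E B $$ (i, j) = adjacency $$ (i, j)"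
      using ij assms(1,2) unfolding symmetric_evolution_algebra_def graphicable_evolution_algebra_def
      by (cases "i = j") (auto simp: adjacency_def)
  qed (auto simp: adjacency_def structural_matrix_def)
qed

lemma dim_evolution_algebra:
  assumes "evolution_algebra E B"
  shows "vectorspace.dim class_ring E = length B"
proof -
  interpret complex_algebra E using assms by (simp add: evolution_algebra_def)
  have "basis (set B)" "distinct B" using assms by (auto simp: evolution_algebra_def natural_basis_def)
  then show ?thesis using dim_basis[of "set B"] by (simp add: distinct_card)
qed

theorem theorem8p2:
  fixes E :: "nat \<Rightarrow> (complex, 'a) module"
    and B :: "nat \<Rightarrow> 'a list"
    and d :: nat
  assumes "EEA_family E B"
    and "\<And>m. m \<ge> 1 \<Longrightarrow> symmetric_evolution_algebra (E m) (B m)"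
    and "\<And>m. m \<ge> 1 \<Longrightarrow> graphicable_evolution_algebra (E m) (B m)"
    and "\<And>m. m \<ge> 1 \<Longrightarrow> regular_evolution_algebra d (E m) (B m)"
  shows "liminf (\<lambda>m. ereal (second_largest_eigenvalue (structural_matrix (E m) (B m))))
           \<ge> ereal (2 * sqrt (real d - 1))"
  unfolding le_Liminf_iff
proof (intro allI impI)
  fix y assume "y < ereal (2 * sqrt (real d - 1))"
  \<comment> \<open>\<open>y\<close> is an extended real and may be minus infinity; a real number
    strictly between is what \<open>alon_boppana\<close> applies to.\<close>
  then obtain \<mu> where \<mu>: "y < ereal \<mu>" "\<mu> < 2 * sqrt (real d - 1)"
    using ereal_dense2 by (metis ereal_less(1) less_ereal.simps(1))
  obtain n0 where n0: "\<And>n N. n \<ge> n0 \<Longrightarrow> regular_graph n d N \<Longrightarrow>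
      \<mu> < second_largest_eigenvalue (regular_graph.adjacency n N)"
    using alon_boppana[OF \<mu>(2)] by blast
  have "eventually (\<lambda>m. vectorspace.dim class_ring (E m) \<ge> n0) sequentially"
    using assms(1) by (simp add: EEA_family_def filterlim_at_top)
  \<comment> \<open>The hypotheses on the algebras speak only of indices from 1 on.\<close>
  moreover have "eventually (\<lambda>m. m \<ge> 1) sequentially" by (rule eventually_ge_at_top)
  ultimately show "eventually
      (\<lambda>m. y < ereal (second_largest_eigenvalue (structural_matrix (E m) (B m)))) sequentially"
  proof eventually_elim
    case (elim m)
    then have "length (B m) \<ge> n0"
      using assms(1) dim_evolution_algebra by (metis EEA_family_def)
    then have "\<mu> < second_largest_eigenvalue (structural_matrix (E m) (B m))"
      unfolding structural_matrix_eq_adjacency[OF assms(2-4)[OF elim(2)]]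
      by (intro n0 regular_graph_evolution_graph assms(4) elim(2))
    then show ?case using \<mu>(1) by (meson less_ereal.simps(1) less_trans)
  qed
qed

end
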